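(* For every real number $\alpha>1$ and every integer $d\ge 3$, there is a constant $A>0$ depending only on $\alpha$ and $d$ such that every $\alpha$-evenly distributed finite point set $X$ in a unit ball in $\mathbb{R}^d$ satisfies $$L(X)\le A\,|X|^{\frac{d+1}{2d}};$$ that is, $L(X)\le O\big(|X|^{\frac{d+1}{2d}}\big)$.
   Context: For a finite point set $X\subset\mathbb{R}^d$, let $V(X)$ be the set of extreme points of $X$, i.e. the vertices of the convex hull $\operatorname{conv}(X)$. The peeling sequence $\{X_i\}_{i\ge 1}$ of $X$ is defined by $X_1=X$ and $X_{i+1}=X_i\setminus V(X_i)$ for $i\ge 1$. The layer number is $L(X)=\min\{k: X_{k+1}=\emptyset\}$. For a constant $\alpha>1$, a finite point set $X$ contained in a unit ball (a ball of radius $1$) in $\mathbb{R}^d$ is called $\alpha$-evenly distributed if $$|X\cap D|\le \big\lceil \alpha\,|X|\operatorname{Vol}(D)\big\rceil$$ for every Euclidean ball $D$ in $\mathbb{R}^d$ with positive volume (any center, any positive radius), where $\operatorname{Vol}$ is the $d$-dimensional volume. *)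

theory Defs
  imports "HOL-Analysis.Analysis"
begin

definition extreme_points :: "'a::real_vector set \<Rightarrow> 'a set" where
  "extreme_points X = {v. v extreme_point_of (convex hull X)}"

text \<open>The peeling sequence, indexed from 0: \<open>peel X k\<close> is the set usually written $X_{k+1}$.\<close>

primrec peel :: "'a::real_vector set \<Rightarrow> nat \<Rightarrow> 'a set" where
  "peel X 0 = X"
| "peel X (Suc k) = peel X k - extreme_points (peel X k)"

text \<open>For finite \<open>X\<close> the sequence reaches the empty set, so the minimum exists; it is 0 exactly
  when \<open>X\<close> is empty.\<close>

definition layer_number :: "'a::real_vector set \<Rightarrow> nat" where
  "layer_number X = (LEAST k. peel X k = {})"

text \<open>Balls are closed. For the balls \<open>D\<close> this includes the open ones: if a finite set
  satisfies the bound for all closed balls, it satisfies it for all open balls as well, since an open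
  ball contains a smaller concentric closed ball with the same trace on the finite set.\<close>

definition evenly_distributed :: "real \<Rightarrow> 'a::euclidean_space set \<Rightarrow> bool" where
  "evenly_distributed \<alpha> X \<longleftrightarrow>
     finite X \<and>
     (\<exists>c. X \<subseteq> cball c 1) \<and>
     (\<forall>c r. r > 0 \<longrightarrow>
        int (card (X \<inter> cball c r)) \<le> \<lceil>\<alpha> * real (card X) * measure lborel (cball c r)\<rceil>)"

end

theory Submission
  imports Defs
begin

text \<open>
  Put \<open>n = |X|\<close> and \<open>s = n powr (- 1 / d)\<close>, so that a ball of radius \<open>s\<close> contains \<open>O(1)\<close> points
  of \<open>X\<close>. If the current layer lies in a ball of radius \<open>r \<le> 1\<close> about the centre \<open>c\<close> and \<open>p\<close> is a
  point of it at distance more than \<open>r - s\<close> from \<open>c\<close>, the cap cut off at \<open>p\<close> perpendicularly to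
  \<open>p - c\<close> has height at most \<open>s\<close> and base radius \<open>O(sqrt s)\<close>, so it is covered by
  \<open>O(s powr (- (d - 1) / 2))\<close> balls of radius \<open>s\<close> and contains as many points up to a constant.
  As long as \<open>p\<close> survives, every peeling step removes a point of this cap, since a linear functional
  is maximised at an extreme point. Hence \<open>O(s powr (- (d - 1) / 2))\<close> steps shrink the ball's
  radius by \<open>s\<close>, and after \<open>O(1 / s)\<close> such rounds nothing is left.
\<close>

section \<open>Peeling and half-spaces\<close>

lemma peel_subset: "peel X k \<subseteq> X"
  by (induction k) auto

lemma peel_antimono: "i \<le> j \<Longrightarrow> peel X j \<subseteq> peel X i"
  by (induction j rule: dec_induct) auto

text \<open>If all extreme points of the hull had functional value below that of \<open>p\<close>,
  an open half-space missing \<open>p\<close> would contain them, hence by Krein-Milman also the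
  whole hull, which contains \<open>p\<close>.\<close>

lemma extreme_point_above:
  fixes S :: "'a::euclidean_space set"
  assumes "finite S" "p \<in> S"
  obtains e where "e \<in> S" "e \<in> extreme_points S" "w \<bullet> p \<le> w \<bullet> e"
proof -
  have "\<exists>e. e extreme_point_of (convex hull S) \<and> w \<bullet> p \<le> w \<bullet> e"
  proof (rule ccontr)
    assume "\<not> ?thesis"
    then have "{e. e extreme_point_of (convex hull S)} \<subseteq> {x. w \<bullet> x < w \<bullet> p}"
      by (auto simp: not_le)
    then have "convex hull {e. e extreme_point_of (convex hull S)} \<subseteq> {x. w \<bullet> x < w \<bullet> p}"
      by (intro hull_minimal convex_halfspace_lt)
    moreover have "convex hull S = convex hull {e. e extreme_point_of (convex hull S)}"
      using assms(1) by (intro Krein_Milman_Minkowski finite_imp_compact_convex_hull) auto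
    moreover have "p \<in> convex hull S"
      using assms(2) by (simp add: hull_inc)
    ultimately show False by auto
  qed
  then show ?thesis
    using that extreme_point_of_convex_hull unfolding extreme_points_def by blast
qed

text \<open>While \<open>p\<close> survives, each step deletes from the half-space bounded by the
  hyperplane through \<open>p\<close> at least the extreme point supplied by
  \<open>extreme_point_above\<close>.\<close>

lemma card_halfspace_peel:
  fixes X :: "'a::euclidean_space set"
  assumes "finite X" "p \<in> peel X (i + m)"
  shows "card (peel X (i + m) \<inter> {x. w \<bullet> p \<le> w \<bullet> x}) + m
           \<le> card (peel X i \<inter> {x. w \<bullet> p \<le> w \<bullet> x})"
  using assms(2)
proof (induction m)
  case (Suc m)
  let ?S = "peel X (i + m)" and ?H = "{x. w \<bullet> p \<le> w \<bullet> x}"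
  have p: "p \<in> ?S" using Suc.prems by simp
  have fin: "finite ?S" using assms(1) peel_subset finite_subset by blast
  obtain e where "e \<in> ?S" "e \<in> extreme_points ?S" "w \<bullet> p \<le> w \<bullet> e"
    using extreme_point_above[OF fin p] .
  then have "peel X (i + Suc m) \<inter> ?H \<subset> ?S \<inter> ?H" by auto
  then have "card (peel X (i + Suc m) \<inter> ?H) < card (?S \<inter> ?H)"
    using fin by (intro psubset_card_mono) auto
  with Suc.IH[OF p] show ?case by simp
qed simp

text \<open>A surviving \<open>p\<close> would itself still count in the half-space after
  \<open>M\<close> deletions, forcing at least \<open>M + 1\<close> points at the start.\<close>

lemma not_in_peel_add:
  fixes X :: "'a::euclidean_space set"
  assumes "finite X" "card (peel X i \<inter> {x. w \<bullet> p \<le> w \<bullet> x}) \<le> M"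
  shows "p \<notin> peel X (i + M)"
proof
  assume p: "p \<in> peel X (i + M)"
  have "finite (peel X (i + M) \<inter> {x. w \<bullet> p \<le> w \<bullet> x})"
    using assms(1) peel_subset finite_subset by blast
  then have "card (peel X (i + M) \<inter> {x. w \<bullet> p \<le> w \<bullet> x}) > 0"
    using p by (subst card_gt_0_iff) auto
  with card_halfspace_peel[OF assms(1) p, of w] assms(2) show False by linarith
qed

section \<open>Counting the points of a thin cap\<close>

lemma card_le_fibres:
  assumes "finite S" "finite T" "f ` S \<subseteq> T"
    and "\<And>x. x \<in> S \<Longrightarrow> card {y \<in> S. f y = f x} \<le> K"
  shows "card S \<le> K * card T"
proof -
  have "card S = card (\<Union>t\<in>f ` S. {y \<in> S. f y = t})"
    by (rule arg_cong[where f = card]) auto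
  also have "\<dots> \<le> (\<Sum>t\<in>f ` S. card {y \<in> S. f y = t})"
    using assms(1) by (intro card_UN_le) auto
  also have "\<dots> \<le> (\<Sum>t\<in>f ` S. K)"
    using assms(4) by (intro sum_mono) auto
  also have "\<dots> \<le> K * card T"
    using assms(2,3) by (simp add: card_mono)
  finally show ?thesis .
qed

lemma card_int_abs_le: "a \<ge> 0 \<Longrightarrow> real (card {- \<lceil>a\<rceil> - 1..\<lceil>a\<rceil>}) \<le> 2 * a + 4"
  by (simp, linarith)

lemma floor_in_abs_range:
  fixes a t :: real
  assumes "\<bar>t\<bar> \<le> a"
  shows "\<lfloor>t\<rfloor> \<in> {- \<lceil>a\<rceil> - 1..\<lceil>a\<rceil>}"
  using assms by (auto simp: abs_le_iff) linarith+

text \<open>Rotate \<open>u\<close> to a coordinate axis and cut space into small cubes. The slab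
  meets boundedly many layers of cubes along that axis and O(1 / sqrt s) in each other direction;
  each cube lies in a ball of radius \<open>s\<close> about any of its points, so it holds at most
  \<open>K\<close> points.\<close>

lemma card_slab_le:
  fixes S :: "(real ^ 'n) set"
  assumes fin: "finite S" and s: "0 < s" "s \<le> 1"
    and u: "norm u = 1"
    and slab: "\<And>x. x \<in> S \<Longrightarrow> \<bar>(x - p) \<bullet> u\<bar> \<le> s \<and> norm (x - p) \<le> sqrt (2 * s)"
    and K: "\<And>x. card (S \<inter> cball x s) \<le> K"
  shows "real (card S)
    \<le> real K * (6 * real CARD('n) * (7 * real CARD('n) / sqrt s) ^ (CARD('n) - 1))"
proof -
  let ?d = "real CARD('n)"
  obtain k :: 'n where True by simp
  have d1: "?d \<ge> 1" by (simp add: Suc_leI)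
  obtain f :: "real ^ 'n \<Rightarrow> real ^ 'n"
    where f: "orthogonal_transformation f" "f u = axis k 1"
    using orthogonal_transformation_exists_1[OF u, of "axis k 1"] by (metis norm_axis_1)
  \<comment> \<open>Points of a common cube of this side differ by at most \<open>\<eta>\<close> in
    each coordinate, hence by at most \<open>s\<close> in the l1 norm, which dominates the Euclidean
    one.\<close>
  define \<eta> where "\<eta> = s / ?d"
  have \<eta>: "\<eta> > 0" using s d1 by (simp add: \<eta>_def)
  define g where "g x = (\<lambda>i. \<lfloor>f (x - p) $ i / \<eta>\<rfloor>)" for x
  \<comment> \<open>Half-widths of the slab in units of \<open>\<eta>\<close>; along
    \<open>u\<close> this is \<open>s / \<eta> = ?d\<close>.\<close>
  define a where "a i = (if i = k then ?d else sqrt (2 * s) / \<eta>)" for i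
  define T where "T = (\<Pi>\<^sub>E i\<in>UNIV. {- \<lceil>a i\<rceil> - 1..\<lceil>a i\<rceil>})"
  have "g x \<in> T" if "x \<in> S" for x
  proof -
    have "\<bar>f (x - p) $ i / \<eta>\<bar> \<le> a i" for i
    proof (cases "i = k")
      case True
      have "f (x - p) $ k = f (x - p) \<bullet> f u"
        by (simp add: f(2) inner_axis)
      also have "\<dots> = (x - p) \<bullet> u"
        using f(1) by (simp add: orthogonal_transformation_def)
      finally have "\<bar>f (x - p) $ k\<bar> \<le> s" using slab[OF that] by simp
      then show ?thesis using True \<eta> s d1
        by (simp add: a_def \<eta>_def abs_mult field_simps)
    next
      case False
      have "\<bar>f (x - p) $ i\<bar> \<le> norm (f (x - p))" by (rule component_le_norm_cart)
      also have "\<dots> = norm (x - p)" using f(1) by (rule orthogonal_transformation_norm)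
      also have "\<dots> \<le> sqrt (2 * s)" using slab[OF that] by simp
      finally show ?thesis using False \<eta> by (simp add: a_def divide_right_mono)
    qed
    then show ?thesis unfolding g_def T_def by (intro PiE_I floor_in_abs_range) auto
  qed
  moreover have "card {y \<in> S. g y = g x} \<le> K" for x
  proof -
    have "{y \<in> S. g y = g x} \<subseteq> S \<inter> cball x s"
    proof (intro subsetI IntI)
      fix y assume y: "y \<in> {y \<in> S. g y = g x}"
      then show "y \<in> S" by simp
      have fxy: "f (x - p) - f (y - p) = f (x - y)"
        using linear_diff[OF orthogonal_transformation_linear[OF f(1)], of "x - p" "y - p"]
        by simp
      have "\<bar>f (x - y) $ i\<bar> \<le> \<eta>" for i
      proof -
        have "\<lfloor>f (y - p) $ i / \<eta>\<rfloor> = \<lfloor>f (x - p) $ i / \<eta>\<rfloor>"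
          using y by (auto simp: g_def dest: fun_cong)
        then have "\<bar>f (x - p) $ i / \<eta> - f (y - p) $ i / \<eta>\<bar> \<le> 1" by linarith
        then have "\<bar>f (x - p) $ i - f (y - p) $ i\<bar> \<le> \<eta>"
          using \<eta> by (simp add: diff_divide_distrib[symmetric] field_simps)
        then show ?thesis by (simp flip: fxy)
      qed
      then have "(\<Sum>i\<in>UNIV. \<bar>f (x - y) $ i\<bar>) \<le> ?d * \<eta>"
        using sum_bounded_above[of UNIV "\<lambda>i. \<bar>f (x - y) $ i\<bar>" \<eta>] by simp
      then have "norm (f (x - y)) \<le> s"
        using norm_le_l1_cart[of "f (x - y)"] by (simp add: \<eta>_def)
      then show "y \<in> cball x s"
        using orthogonal_transformation_norm[OF f(1)] by (simp add: dist_norm)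
    qed
    then have "card {y \<in> S. g y = g x} \<le> card (S \<inter> cball x s)"
      using fin by (intro card_mono) auto
    then show ?thesis using K[of x] by linarith
  qed
  moreover have finT: "finite T" unfolding T_def by (intro finite_PiE) auto
  ultimately have "card S \<le> K * card T"
    using card_le_fibres[OF fin finT, of g K] by blast
  then have "real (card S) \<le> real K * real (card T)"
    by (metis of_nat_le_iff of_nat_mult)
  also have "real (card T) \<le> 6 * ?d * (7 * ?d / sqrt s) ^ (CARD('n) - 1)"
  proof -
    have root: "sqrt s \<le> 1" "sqrt s > 0" using s by auto
    have "sqrt (2 * s) / \<eta> = sqrt 2 * ?d / sqrt s"
      using s d1 by (simp add: \<eta>_def real_sqrt_mult field_simps)
    also have "\<dots> \<le> 1.5 * ?d / sqrt s"
      using root d1 by (intro divide_right_mono mult_right_mono real_le_lsqrt)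
        (auto simp: power2_eq_square)
    finally have small: "sqrt (2 * s) / \<eta> \<le> 1.5 * ?d / sqrt s" .
    \<comment> \<open>The additive 4 is absorbed into \<open>4 * ?d / sqrt s\<close>; with twice 1.5
      this gives the constant 7.\<close>
    have "sqrt s \<le> ?d" using root d1 by linarith
    then have "1 \<le> ?d / sqrt s" using root by (simp add: le_divide_eq)
    with small have other: "2 * (sqrt (2 * s) / \<eta>) + 4 \<le> 7 * ?d / sqrt s" by simp
    have a0: "a i \<ge> 0" for i using s \<eta> by (simp add: a_def)
    have "real (card T) = (\<Prod>i\<in>UNIV. real (card {- \<lceil>a i\<rceil> - 1..\<lceil>a i\<rceil>}))"
      unfolding T_def by (subst card_PiE) (auto simp del: card_atLeastAtMost_int)
    also have "\<dots> \<le> (\<Prod>i\<in>UNIV. 2 * a i + 4)"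
      using a0 by (intro prod_mono conjI card_int_abs_le) auto
    \<comment> \<open>The axis direction contributes a factor free of \<open>s\<close>, which leaves
      the exponent \<open>CARD('n) - 1\<close>.\<close>
    also have "\<dots> = (2 * ?d + 4) * (\<Prod>i\<in>UNIV - {k}. 2 * a i + 4)"
      by (subst prod.remove[of _ k]) (auto simp: a_def)
    also have "(\<Prod>i\<in>UNIV - {k}. 2 * a i + 4) = (2 * (sqrt (2 * s) / \<eta>) + 4) ^ (CARD('n) - 1)"
      by (simp add: a_def card_Diff_singleton)
    also have "(2 * ?d + 4) * \<dots> \<le> 6 * ?d * (7 * ?d / sqrt s) ^ (CARD('n) - 1)"
      using d1 other \<eta> s by (intro mult_mono power_mono) auto
    finally show ?thesis .
  qed
  finally show ?thesis by (simp add: mult_left_mono)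
qed

text \<open>Put \<open>v = p - c\<close> and \<open>z = x - p\<close>. From
  \<open>norm (z + v) \<le> r\<close> and \<open>v \<bullet> z \<ge> 0\<close>, expanding the square
  bounds the squared norm of \<open>z\<close> by
  \<open>(r - norm v) * (r + norm v) \<le> 2 * s\<close>, while the height of \<open>z\<close> along
  \<open>v\<close> is at most \<open>r - norm v < s\<close>.\<close>

lemma cap_in_slab:
  fixes p c :: "real ^ 'n"
  assumes r: "r \<le> 1" and s: "s \<le> 1" and p: "dist c p \<le> r" "r - s < dist c p"
  obtains u where "norm u = 1"
    and "\<And>x. dist c x \<le> r \<Longrightarrow> (p - c) \<bullet> p \<le> (p - c) \<bullet> x
          \<Longrightarrow> \<bar>(x - p) \<bullet> u\<bar> \<le> s \<and> norm (x - p) \<le> sqrt (2 * s)"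
proof -
  define v where "v = p - c"
  have v: "norm v \<le> r" "r - s < norm v"
    using p by (auto simp: v_def dist_norm norm_minus_commute)
  obtain k :: 'n where True by simp
  \<comment> \<open>If \<open>p\<close> is the centre, any unit vector serves: then
    \<open>r < s\<close>, so the whole ball lies within \<open>s\<close> of
    \<open>p\<close>.\<close>
  define u where "u = (if v = 0 then axis k 1 else v /\<^sub>R norm v)"
  have u: "norm u = 1" by (simp add: u_def norm_axis_1)
  show ?thesis
  proof (rule that[OF u])
    fix x assume x: "dist c x \<le> r" and "(p - c) \<bullet> p \<le> (p - c) \<bullet> x"
    then have vz: "v \<bullet> (x - p) \<ge> 0" by (simp add: v_def inner_diff_right)
    have y: "norm (x - p + v) \<le> r" using x by (simp add: v_def dist_norm norm_minus_commute)
    have "(norm (x - p + v))\<^sup>2 \<le> r\<^sup>2" using y by (intro power_mono) auto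
    then have "(norm (x - p))\<^sup>2 \<le> r\<^sup>2 - (norm v)\<^sup>2"
      using vz by (simp add: power2_norm_eq_inner inner_simps inner_commute)
    also have "\<dots> = (r - norm v) * (r + norm v)"
      by (simp add: power2_eq_square algebra_simps)
    also have "\<dots> \<le> s * 2" using v r norm_ge_zero[of v] by (intro mult_mono) linarith+
    finally have sq: "norm (x - p) \<le> sqrt (2 * s)" by (intro real_le_rsqrt) simp
    have "\<bar>(x - p) \<bullet> u\<bar> \<le> s"
    proof (cases "v = 0")
      case True
      then have "norm (x - p) \<le> s" using y v by simp
      then show ?thesis using Cauchy_Schwarz_ineq2[of "x - p" u] u by simp
    next
      case False
      then have vu: "v = norm v *\<^sub>R u" by (simp add: u_def)
      have "(x - p) \<bullet> u \<ge> 0" using vz False by (simp add: u_def inner_commute)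
      moreover have "(x - p + v) \<bullet> u \<le> r"
        using Cauchy_Schwarz_ineq2[of "x - p + v" u] u y by simp
      moreover have "v \<bullet> u = norm v"
        using u by (subst vu) (simp add: norm_eq_1)
      ultimately show ?thesis using v by (simp add: inner_add_left)
    qed
    with sq show "\<bar>(x - p) \<bullet> u\<bar> \<le> s \<and> norm (x - p) \<le> sqrt (2 * s)" by simp
  qed
qed

section \<open>Shrinking the enclosing ball\<close>

text \<open>A point outside the smaller ball that survived a round of \<open>M\<close> steps would
  contradict \<open>not_in_peel_add\<close>, because its cap holds at most \<open>M\<close> points.
  A negative radius is allowed and means an empty ball, which is how the peeling is shown to
  end.\<close>

lemma peel_shrinks:
  fixes X :: "(real ^ 'n) set"
  assumes fin: "finite X" and X: "X \<subseteq> cball c 1" and s: "0 < s" "s \<le> 1"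
    and K: "\<And>x. card (X \<inter> cball x s) \<le> K"
    and M: "real K * (6 * real CARD('n) * (7 * real CARD('n) / sqrt s) ^ (CARD('n) - 1)) \<le> real M"
  shows "peel X (j * M) \<subseteq> cball c (1 - real j * s)"
proof (induction j)
  case 0
  then show ?case using X by simp
next
  case (Suc j)
  define r where "r = 1 - real j * s"
  let ?Y = "peel X (j * M)"
  have r: "r \<le> 1" using s by (simp add: r_def)
  have Y: "?Y \<subseteq> cball c r" using Suc by (simp add: r_def)
  show ?case
  proof
    fix p assume p: "p \<in> peel X (Suc j * M)"
    show "p \<in> cball c (1 - real (Suc j) * s)"
    proof (rule ccontr)
      assume "p \<notin> cball c (1 - real (Suc j) * s)"
      then have far: "r - s < dist c p" by (simp add: r_def algebra_simps)
      have "p \<in> ?Y" using p peel_antimono[of "j * M" "Suc j * M" X] by auto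
      then have near: "dist c p \<le> r" using Y by auto
      obtain u where u: "norm u = 1"
        and slab: "\<And>x. dist c x \<le> r \<Longrightarrow> (p - c) \<bullet> p \<le> (p - c) \<bullet> x
          \<Longrightarrow> \<bar>(x - p) \<bullet> u\<bar> \<le> s \<and> norm (x - p) \<le> sqrt (2 * s)"
        using cap_in_slab[OF r s(2) near far] by blast
      define S where "S = ?Y \<inter> {x. (p - c) \<bullet> p \<le> (p - c) \<bullet> x}"
      have SX: "S \<subseteq> X" using peel_subset unfolding S_def by blast
      have finS: "finite S" using SX fin finite_subset by blast
      have KS: "card (S \<inter> cball x s) \<le> K" for x
      proof -
        have "card (S \<inter> cball x s) \<le> card (X \<inter> cball x s)"
          using SX fin by (intro card_mono) auto
        then show ?thesis using K[of x] by linarith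
      qed
      have "real (card S)
          \<le> real K * (6 * real CARD('n) * (7 * real CARD('n) / sqrt s) ^ (CARD('n) - 1))"
        by (rule card_slab_le[OF finS s u _ KS, of p], rule slab) (use Y in \<open>auto simp: S_def\<close>)
      with M have "card S \<le> M" by linarith
      then have "p \<notin> peel X (j * M + M)"
        unfolding S_def by (intro not_in_peel_add[OF fin])
      with p show False by (simp add: add.commute)
    qed
  qed
qed

section \<open>Choice of parameters and the final exponent\<close>

theorem theorem1p4:
  fixes \<alpha> :: real
  assumes "\<alpha> > 1" and "CARD('n::finite) \<ge> 3"
  shows "\<exists>A>0. \<forall>X :: (real ^ 'n) set. evenly_distributed \<alpha> X \<longrightarrow>
           real (layer_number X)
             \<le> A * real (card X) powr ((real CARD('n) + 1) / (2 * real CARD('n)))"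
proof -
  let ?d = "real CARD('n)"
  have d1: "?d \<ge> 1" by (simp add: Suc_leI)
  \<comment> \<open>For a ball of radius \<open>s = n powr (- 1 / ?d)\<close> the factor
    \<open>n\<close> cancels against its volume, so \<open>K\<close> and \<open>C\<close> depend
    only on \<open>\<alpha>\<close> and the dimension.\<close>
  define K where "K = nat \<lceil>\<alpha> * unit_ball_vol ?d\<rceil>"
  define C where "C = real K * (6 * ?d * (7 * ?d) ^ (CARD('n) - 1))"
  have C0: "C \<ge> 0" by (simp add: C_def)
  show ?thesis
  \<comment> \<open>The 3 comes from rounding up the number of rounds \<open>J\<close>, and
    \<open>C + 1\<close> from rounding up their length \<open>M\<close>.\<close>
  proof (intro exI[of _ "3 * (C + 1)"] conjI allI impI)
    show "3 * (C + 1) > 0" using C0 by simp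
    fix X :: "(real ^ 'n) set"
    assume ed: "evenly_distributed \<alpha> X"
    then have fin: "finite X" by (simp add: evenly_distributed_def)
    obtain c where c: "X \<subseteq> cball c 1" using ed by (auto simp: evenly_distributed_def)
    show "real (layer_number X) \<le> 3 * (C + 1) * real (card X) powr ((?d + 1) / (2 * ?d))"
    \<comment> \<open>The empty set is treated apart, since \<open>0 powr _ = 0\<close> would make
      \<open>s\<close> zero.\<close>
    proof (cases "X = {}")
      case True
      then have "layer_number X = 0"
        unfolding layer_number_def by (intro Least_eq_0) simp
      then show ?thesis using C0 by simp
    next
      case False
      define n where "n = real (card X)"
      have n: "n \<ge> 1" using False fin by (simp add: n_def Suc_leI card_gt_0_iff)
      define s where "s = n powr (- 1 / ?d)"
      have s: "0 < s" "s \<le> 1"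
        using n d1 powr_mono[of "- 1 / ?d" 0 n] by (auto simp: s_def)
      have "s ^ CARD('n) = s powr ?d" using s by (simp add: powr_realpow)
      also have "\<dots> = n powr (- 1 / ?d * ?d)" unfolding s_def by (rule powr_powr)
      also have "- 1 / ?d * ?d = - 1" using d1 by simp
      also have "n powr (- 1) = 1 / n" using n by (simp add: powr_minus_divide)
      finally have "s ^ CARD('n) = 1 / n" .
      then have vol: "\<alpha> * n * measure lborel (cball x s) = \<alpha> * unit_ball_vol ?d"
        for x :: "real ^ 'n"
        using n s content_cball[of s x] by simp
      have KX: "card (X \<inter> cball x s) \<le> K" for x
      proof -
        have "int (card (X \<inter> cball x s)) \<le> \<lceil>\<alpha> * n * measure lborel (cball x s)\<rceil>"
          using ed s unfolding evenly_distributed_def n_def by blast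
        then show ?thesis unfolding vol K_def by linarith
      qed
      define b where "b = s powr (- ((?d - 1) / 2))"
      have b: "b \<ge> 1"
        using s d1 powr_mono'[of "- ((?d - 1) / 2)" 0 s] by (simp add: b_def)
      have "(1 / sqrt s) ^ (CARD('n) - 1) = b"
      proof -
        have "1 / sqrt s = s powr (- 1 / 2)"
          using s by (simp add: powr_half_sqrt powr_minus_divide)
        then show ?thesis using s
          by (simp add: b_def powr_powr of_nat_diff Suc_leI algebra_simps diff_divide_distrib
              flip: powr_realpow)
      qed
      then have Cb: "real K * (6 * ?d * (7 * ?d / sqrt s) ^ (CARD('n) - 1)) = C * b"
        by (auto simp: C_def power_divide)
      define M where "M = nat \<lceil>C * b\<rceil>"
      have M: "C * b \<le> real M" "real M \<le> (C + 1) * b"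
        using C0 b by (auto simp: M_def algebra_simps) linarith+
      \<comment> \<open>The extra round makes the final radius strictly negative; a ball of radius 0
        could still contain its centre.\<close>
      define J where "J = nat \<lceil>1 / s\<rceil> + 1"
      have J: "1 / s < real J" "real J \<le> 3 / s"
      proof -
        show "1 / s < real J" unfolding J_def by linarith
        have "1 / s \<ge> 1" using s by simp
        then show "real J \<le> 3 / s" unfolding J_def by linarith
      qed
      have "1 - real J * s < 0" using J(1) s by (simp add: field_simps)
      moreover have "peel X (J * M) \<subseteq> cball c (1 - real J * s)"
        using M(1) unfolding Cb[symmetric] by (rule peel_shrinks[OF fin c s KX])
      ultimately have "peel X (J * M) = {}" by simp
      then have "layer_number X \<le> J * M"
        unfolding layer_number_def by (rule Least_le)
      then have "real (layer_number X) \<le> real J * real M"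
        by (metis of_nat_le_iff of_nat_mult)
      also have "\<dots> \<le> (3 / s) * ((C + 1) * b)"
        using J M s by (intro mult_mono) auto
      also have "\<dots> = 3 * (C + 1) * (s powr (-1) * b)"
        using s by (simp add: powr_minus_divide)
      \<comment> \<open>Number of rounds times length of a round: the exponents of \<open>s\<close>
        add up to \<open>- ((?d + 1) / 2)\<close>, and substituting \<open>s\<close> divides by
        \<open>- ?d\<close>.\<close>
      also have "s powr (-1) * b = n powr ((?d + 1) / (2 * ?d))"
      proof -
        have "s powr (-1) * b = s powr (- 1 + - ((?d - 1) / 2))"
          unfolding b_def by (rule powr_add[symmetric])
        also have "- 1 + - ((?d - 1) / 2) = - ((?d + 1) / 2)" by (simp add: field_simps)
        finally show ?thesis using d1 by (simp add: s_def powr_powr field_simps)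
      qed
      finally show ?thesis unfolding n_def .
    qed
  qed
qed

end
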